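(* For all positive integers $m,h,p$, $$hm^{p}S_{p}(h,m)+mh^{p}S_{p}(m,h)=\sum_{\mu=0}^{m-1}\sum_{\nu=0}^{h-1}(mh)^{p-1}(\mu h+m\nu)\,\overline{B}_{p}\Big(\frac{\nu}{h}+\frac{\mu}{m}\Big)=(mh)^{p}\sum_{\mu=0}^{m-1}\sum_{\nu=0}^{h-1}(mh)^{-1}(\mu h+m\nu)\,\overline{B}_{p}\Big(\frac{\nu}{h}+\frac{\mu}{m}\Big).$$
   Context: The Bernoulli polynomials $B_n(x)$ are defined by $\frac{t}{e^{t}-1}e^{xt}=\sum_{n=0}^{\infty}B_{n}(x)\frac{t^{n}}{n!}$. For real $x$, $\langle x\rangle=x-[x]$ is the fractional part, where $[x]$ is the greatest integer not exceeding $x$, and $\overline{B}_n(x)=B_n(\langle x\rangle)$. For positive integers $h,m,p$, the generalized Dedekind sum (Apostol) is $S_{p}(h,m)=\sum_{\mu=1}^{m-1}\frac{\mu}{m}\,\overline{B}_{p}\big(\frac{h\mu}{m}\big)$. *)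

theory Defs
  imports Complex_Main "HOL-Computational_Algebra.Formal_Power_Series"
begin

(* B_n(x), read off as n! times the coefficient of t^n in t / (e^t - 1) * e^(x t).
   The division is that of formal power series over a field, which is exact here
   since t divides e^t - 1 exactly once; see bernpoly_generating_function. *)
definition bernpoly :: "nat \<Rightarrow> real \<Rightarrow> real" where
  "bernpoly n x = fact n * fps_nth (fps_X / (fps_exp 1 - 1) * fps_exp x) n"

lemma bernpoly_generating_function:
  "Abs_fps (\<lambda>n. bernpoly n x / fact n) * (fps_exp 1 - 1) = fps_X * fps_exp x"
proof -
  let ?E = "fps_exp 1 - 1 :: real fps"
  have 1: "fps_nth ?E 1 \<noteq> 0" and 0: "fps_nth ?E 0 = 0"
    by simp_all
  have nz: "?E \<noteq> 0"
    using 1 by force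
  have "subdegree ?E = 1"
    using 0 1 by (intro subdegreeI) auto
  hence "?E dvd fps_X"
    using nz by (subst fps_dvd_iff) auto
  hence "fps_X / ?E * ?E = fps_X"
    by simp
  moreover have "Abs_fps (\<lambda>n. bernpoly n x / fact n) = fps_X / ?E * fps_exp x"
    by (rule fps_ext) (simp add: bernpoly_def)
  ultimately show ?thesis
    by (metis mult.assoc mult.commute)
qed

definition periodic_bernpoly :: "nat \<Rightarrow> real \<Rightarrow> real" where
  "periodic_bernpoly n x = bernpoly n (frac x)"

definition dedekind_sum :: "nat \<Rightarrow> nat \<Rightarrow> nat \<Rightarrow> real" where
  "dedekind_sum p h m =
     (\<Sum>\<mu> = 1..<m. real \<mu> / real m * periodic_bernpoly p (real h * real \<mu> / real m))"

end

(* The generating function turns a geometric sum of exponentials into Raabe's multiplication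
   formula, which extends to all real arguments for the periodic Bernoulli functions. Splitting
   mu h + m nu in the double sum, one of the two inner sums is then evaluated by this formula,
   and each half becomes a Dedekind sum. *)
theory Submission
  imports Defs
begin

text \<open>Raabe's formula, by comparing generating functions: that of the sum over
  \<open>\<nu>\<close>, divided by h, and that of B_n(h y) at t/h both become (t/h) e^(y t) after
  multiplication by e^(t/h) - 1. Writing h^n on the left and h on the right avoids the exponent n -
  1, so n = 0 is included.\<close>

lemma bernpoly_multiplication:
  fixes y :: real
  assumes "h > 0"
  shows "real h ^ n * (\<Sum>\<nu> = 0..<h. bernpoly n (y + real \<nu> / real h)) =
           real h * bernpoly n (real h * y)"
proof -
  define G where "G x = Abs_fps (\<lambda>n. bernpoly n x / fact n)" for x :: real
  define c where "c = inverse (real h)"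
  \<comment> \<open>\<open>L\<close> is the series t/h; composing with it multiplies the n-th
    coefficient by h^(-n), which is where the power of h in the formula comes from.\<close>
  define L where "L = fps_const c * fps_X"
  have c: "c * real h = 1" "c * (real h * z) = z" "c \<noteq> 0" for z
    using assms by (simp_all add: c_def)
  have G: "G x * (fps_exp 1 - 1) = fps_X * fps_exp x" for x
    unfolding G_def by (rule bernpoly_generating_function)
  have exp_nz: "fps_exp a - 1 \<noteq> 0" if "a \<noteq> 0" for a :: real
  proof
    assume "fps_exp a - 1 = 0"
    hence "fps_nth (fps_exp a - 1) 1 = 0" by simp
    with that show False by simp
  qed
  have exp_L: "fps_compose (fps_exp a) L = fps_exp (c * a)" for a
    by (rule fps_ext) (simp add: L_def fps_compose_linear power_mult_distrib)
  have L0: "fps_nth L 0 = 0" by (simp add: L_def)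
  \<comment> \<open>The summands form a geometric progression with ratio e^(t/h), whose h-th power
    is e^t.\<close>
  have geom: "(\<Sum>\<nu> = 0..<h. fps_exp (y + real \<nu> / real h)) * (fps_exp c - 1) =
                fps_exp y * (fps_exp 1 - 1)"
  proof -
    have "fps_exp (y + real \<nu> / real h) = fps_exp y * fps_exp c ^ \<nu>" for \<nu>
      by (simp add: fps_exp_add_mult fps_exp_power_mult c_def field_simps)
    hence "(\<Sum>\<nu> = 0..<h. fps_exp (y + real \<nu> / real h)) * (fps_exp c - 1) =
             fps_exp y * ((fps_exp c - 1) * (\<Sum>\<nu><h. fps_exp c ^ \<nu>))"
      by (simp add: sum_distrib_left[symmetric] algebra_simps atLeast0LessThan)
    also have "(fps_exp c - 1) * (\<Sum>\<nu><h. fps_exp c ^ \<nu>) = fps_exp c ^ h - 1"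
      by (rule power_diff_1_eq[symmetric])
    also have "fps_exp c ^ h = fps_exp 1"
      using c by (simp add: fps_exp_power_mult mult.commute)
    finally show ?thesis .
  qed
  \<comment> \<open>Substituting t/h in the generating function at h y turns e^t - 1 into e^(t/h) -
    1 and e^(h y t) into e^(y t).\<close>
  have "fps_compose (G (real h * y) * (fps_exp 1 - 1)) L =
          fps_compose (fps_X * fps_exp (real h * y)) L"
    by (simp add: G)
  hence scaled: "fps_compose (G (real h * y)) L * (fps_exp c - 1) = L * fps_exp y"
    using L0 by (simp add: fps_compose_mult_distrib fps_compose_sub_distrib exp_L c)
  \<comment> \<open>The extra factor e^t - 1 allows \<open>G\<close> to be applied to each summand;
    \<open>geom\<close> then reproduces this factor on the right, where it cancels because power
    series over a field have no zero divisors.\<close>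
  have "(\<Sum>\<nu> = 0..<h. G (y + real \<nu> / real h)) * (fps_exp c - 1) * (fps_exp 1 - 1) =
          (\<Sum>\<nu> = 0..<h. G (y + real \<nu> / real h) * (fps_exp 1 - 1)) * (fps_exp c - 1)"
    by (simp only: sum_distrib_left mult_ac)
  also have "\<dots> = fps_X * ((\<Sum>\<nu> = 0..<h. fps_exp (y + real \<nu> / real h)) * (fps_exp c - 1))"
    by (simp only: G sum_distrib_left[symmetric] mult.assoc)
  also have "\<dots> = fps_X * fps_exp y * (fps_exp 1 - 1)"
    by (simp only: geom mult.assoc)
  finally have "(\<Sum>\<nu> = 0..<h. G (y + real \<nu> / real h)) * (fps_exp c - 1) = fps_X * fps_exp y"
    using exp_nz[of 1] by simp
  hence "(fps_const c * (\<Sum>\<nu> = 0..<h. G (y + real \<nu> / real h))) * (fps_exp c - 1) =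
           fps_compose (G (real h * y)) L * (fps_exp c - 1)"
    unfolding scaled by (simp add: L_def mult.assoc)
  hence "fps_const c * (\<Sum>\<nu> = 0..<h. G (y + real \<nu> / real h)) = fps_compose (G (real h * y)) L"
    using exp_nz[of c] c by simp
  hence "fps_nth (fps_const c * (\<Sum>\<nu> = 0..<h. G (y + real \<nu> / real h))) n =
           fps_nth (fps_compose (G (real h * y)) L) n"
    by (rule arg_cong)
  hence "c * (\<Sum>\<nu> = 0..<h. bernpoly n (y + real \<nu> / real h)) = c ^ n * bernpoly n (real h * y)"
    by (simp add: L_def fps_compose_linear fps_sum_nth G_def sum_divide_distrib[symmetric])
  thus ?thesis
    using assms by (simp add: c_def field_simps)
qed

text \<open>Modulo 1, the points x + \<open>\<nu>\<close>/h are a permutation of y + j/h with 0 <= j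
  < h, where y lies in [0, 1/h) and h y is the fractional part of h x. All these points lie in [0,
  1), so the formula for polynomials at y applies.\<close>

lemma periodic_bernpoly_multiplication:
  fixes x :: real
  assumes "h > 0"
  shows "real h ^ n * (\<Sum>\<nu> = 0..<h. periodic_bernpoly n (x + real \<nu> / real h)) =
           real h * periodic_bernpoly n (real h * x)"
proof -
  define k where "k = \<lfloor>real h * x\<rfloor>"
  define y where "y = frac (real h * x) / real h"
  \<comment> \<open>The position of x + \<open>\<nu>\<close>/h among the points y + j/h. The residue
    is taken over the integers since \<open>k\<close> may be negative.\<close>
  define r where "r \<nu> = nat ((k + int \<nu>) mod int h)" for \<nu>
  have r_less: "r \<nu> < h" for \<nu>
    using assms by (simp add: r_def nat_less_iff)
  have frac_eq: "frac (x + real \<nu> / real h) = y + real (r \<nu>) / real h" for \<nu>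
  proof (subst frac_unique_iff, intro conjI)
    \<comment> \<open>Division of k + \<open>\<nu>\<close> by h with remainder: the quotient is the
      integer by which x + \<open>\<nu>\<close>/h and its representative differ.\<close>
    have "real_of_int (k + int \<nu>) = 
            real_of_int (int h * ((k + int \<nu>) div int h) + int (r \<nu>))"
      using assms by (simp add: r_def)
    hence "real_of_int k + real \<nu> = real h * real_of_int ((k + int \<nu>) div int h) + real (r \<nu>)"
      by simp
    moreover have "real h * x = real_of_int k + frac (real h * x)"
      by (simp add: k_def frac_def)
    ultimately have "real h * x + real \<nu> - (frac (real h * x) + real (r \<nu>)) =
                       real h * real_of_int ((k + int \<nu>) div int h)"
      by linarith
    moreover have "x + real \<nu> / real h - (y + real (r \<nu>) / real h) =
                     (real h * x + real \<nu> - (frac (real h * x) + real (r \<nu>))) / real h"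
      using assms by (simp add: y_def add_divide_distrib diff_divide_distrib)
    ultimately have "x + real \<nu> / real h - (y + real (r \<nu>) / real h) =
                       real_of_int ((k + int \<nu>) div int h)"
      using assms by simp
    thus "x + real \<nu> / real h - (y + real (r \<nu>) / real h) \<in> \<int>"
      by simp
    show "0 \<le> y + real (r \<nu>) / real h"
      by (simp add: y_def)
    \<comment> \<open>As \<open>r \<nu>\<close> is an integer below h, it is at most h - 1, leaving
      room for a fractional part below 1.\<close>
    have "real (r \<nu>) + 1 \<le> real h"
      using r_less[of \<nu>] by linarith
    hence "frac (real h * x) + real (r \<nu>) < real h"
      using frac_lt_1[of "real h * x"] by linarith
    thus "y + real (r \<nu>) / real h < 1"
      using assms by (simp add: y_def field_simps)
  qed
  have "inj_on r {0..<h}"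
  proof (rule inj_onI)
    fix a b assume ab: "a \<in> {0..<h}" "b \<in> {0..<h}" "r a = r b"
    hence "(k + int a) mod int h = (k + int b) mod int h"
      using assms by (simp add: r_def eq_nat_nat_iff)
    hence "int h dvd int a - int b"
      by (simp add: mod_eq_dvd_iff)
    hence "int a mod int h = int b mod int h"
      by (simp add: mod_eq_dvd_iff)
    with ab show "a = b" by simp
  qed
  moreover have "r ` {0..<h} \<subseteq> {0..<h}"
    using r_less by auto
  ultimately have "bij_betw r {0..<h} {0..<h}"
    by (simp add: bij_betw_def endo_inj_surj)
  hence "(\<Sum>\<nu> = 0..<h. bernpoly n (y + real (r \<nu>) / real h)) =
           (\<Sum>\<nu> = 0..<h. bernpoly n (y + real \<nu> / real h))"
    by (rule sum.reindex_bij_betw)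
  moreover have "real h * y = frac (real h * x)"
    using assms by (simp add: y_def)
  ultimately show ?thesis
    using bernpoly_multiplication[OF assms, of n y]
    by (simp add: periodic_bernpoly_def frac_eq)
qed

text \<open>For fixed \<open>\<mu>\<close> the weight does not depend on \<open>\<nu>\<close>, so
  the inner sum is the periodic multiplication formula at \<open>\<mu>\<close>/m; the factor h of
  the weight completes h^(p-1) to the h^p required there.\<close>

lemma dedekind_sum_eq_double_sum:
  fixes m h p :: nat
  assumes "m > 0" and "h > 0" and "p > 0"
  shows "real h * real m ^ p * dedekind_sum p h m =
           (\<Sum>\<mu> = 0..<m. \<Sum>\<nu> = 0..<h. (real m * real h) ^ (p - 1) * (real \<mu> * real h) *
              periodic_bernpoly p (real \<nu> / real h + real \<mu> / real m))"
proof -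
  \<comment> \<open>Since p > 0, the subtraction in p - 1 is not truncated.\<close>
  have pow: "real a ^ p = real a * real a ^ (p - 1)" for a
    using assms by (simp add: power_eq_if)
  have "(\<Sum>\<nu> = 0..<h. (real m * real h) ^ (p - 1) * (real \<mu> * real h) *
              periodic_bernpoly p (real \<nu> / real h + real \<mu> / real m)) =
          real h * real m ^ p * (real \<mu> / real m * periodic_bernpoly p (real h * real \<mu> / real m))"
    for \<mu>
  proof -
    have "(\<Sum>\<nu> = 0..<h. (real m * real h) ^ (p - 1) * (real \<mu> * real h) *
              periodic_bernpoly p (real \<nu> / real h + real \<mu> / real m)) =
            real m ^ (p - 1) * real \<mu> *
              (real h ^ p * (\<Sum>\<nu> = 0..<h. periodic_bernpoly p (real \<mu> / real m + real \<nu> / real h)))"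
      by (simp add: sum_distrib_left power_mult_distrib pow add.commute mult_ac)
    also have "\<dots> = real m ^ (p - 1) * real \<mu> *
                       (real h * periodic_bernpoly p (real h * (real \<mu> / real m)))"
      using assms by (simp only: periodic_bernpoly_multiplication)
    also have "\<dots> = real h * real m ^ p *
                       (real \<mu> / real m * periodic_bernpoly p (real h * real \<mu> / real m))"
      using assms by (simp add: pow)
    finally show ?thesis .
  qed
  hence "(\<Sum>\<mu> = 0..<m. \<Sum>\<nu> = 0..<h. (real m * real h) ^ (p - 1) * (real \<mu> * real h) *
              periodic_bernpoly p (real \<nu> / real h + real \<mu> / real m)) =
          real h * real m ^ p *
            (\<Sum>\<mu> = 0..<m. real \<mu> / real m * periodic_bernpoly p (real h * real \<mu> / real m))"
    by (simp only: sum_distrib_left)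
  \<comment> \<open>The sum may start at 0 instead of 1 because the weight \<open>\<mu>\<close>/m
    vanishes there.\<close>
  also have "(\<Sum>\<mu> = 0..<m. real \<mu> / real m * periodic_bernpoly p (real h * real \<mu> / real m)) =
               dedekind_sum p h m"
    using assms by (simp add: dedekind_sum_def sum.atLeast_Suc_lessThan)
  finally show ?thesis ..
qed

theorem corollary11:
  fixes m h p :: nat
  assumes "m > 0" and "h > 0" and "p > 0"
  shows "real h * real m ^ p * dedekind_sum p h m + real m * real h ^ p * dedekind_sum p m h =
           (\<Sum>\<mu> = 0..<m. \<Sum>\<nu> = 0..<h.
              (real m * real h) ^ (p - 1) * (real \<mu> * real h + real m * real \<nu>) *
                periodic_bernpoly p (real \<nu> / real h + real \<mu> / real m)) \<and>
         (\<Sum>\<mu> = 0..<m. \<Sum>\<nu> = 0..<h.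
              (real m * real h) ^ (p - 1) * (real \<mu> * real h + real m * real \<nu>) *
                periodic_bernpoly p (real \<nu> / real h + real \<mu> / real m)) =
           (real m * real h) ^ p *
             (\<Sum>\<mu> = 0..<m. \<Sum>\<nu> = 0..<h.
                inverse (real m * real h) * (real \<mu> * real h + real m * real \<nu>) *
                  periodic_bernpoly p (real \<nu> / real h + real \<mu> / real m))"
proof
  let ?B = "\<lambda>\<mu> \<nu>. periodic_bernpoly p (real \<nu> / real h + real \<mu> / real m)"
  \<comment> \<open>The lemma with m and h exchanged: the argument of the periodic function is
    symmetric under this exchange, so only the order of summation has to be restored.\<close>
  have "real m * real h ^ p * dedekind_sum p m h =
          (\<Sum>\<nu> = 0..<h. \<Sum>\<mu> = 0..<m. (real m * real h) ^ (p - 1) * (real m * real \<nu>) * ?B \<mu> \<nu>)"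
    using dedekind_sum_eq_double_sum[OF assms(2,1,3)] by (simp add: mult.commute add.commute)
  also have "\<dots> = (\<Sum>\<mu> = 0..<m. \<Sum>\<nu> = 0..<h.
                     (real m * real h) ^ (p - 1) * (real m * real \<nu>) * ?B \<mu> \<nu>)"
    by (rule sum.swap)
  finally show "real h * real m ^ p * dedekind_sum p h m + real m * real h ^ p * dedekind_sum p m h =
      (\<Sum>\<mu> = 0..<m. \<Sum>\<nu> = 0..<h.
         (real m * real h) ^ (p - 1) * (real \<mu> * real h + real m * real \<nu>) * ?B \<mu> \<nu>)"
    using dedekind_sum_eq_double_sum[OF assms]
    by (simp only: sum.distrib[symmetric] distrib_left distrib_right)
  have "(real m * real h) ^ (p - 1) = (real m * real h) ^ p * inverse (real m * real h)"
    using power_minus_mult[OF assms(3), of "real m * real h"] assms by (simp add: field_simps)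
  thus "(\<Sum>\<mu> = 0..<m. \<Sum>\<nu> = 0..<h.
           (real m * real h) ^ (p - 1) * (real \<mu> * real h + real m * real \<nu>) * ?B \<mu> \<nu>) =
        (real m * real h) ^ p *
          (\<Sum>\<mu> = 0..<m. \<Sum>\<nu> = 0..<h.
             inverse (real m * real h) * (real \<mu> * real h + real m * real \<nu>) * ?B \<mu> \<nu>)"
    by (simp only: sum_distrib_left mult.assoc)
qed

end
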